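(* Let $\Gamma$ be a countable discrete group and $\mu$ a symmetric probability measure on $\Gamma$. Let $T\in\mathcal B(\ell^2(\Gamma))$ satisfy $\mathcal P_\mu(\mathcal P^o_\mu(T))=T$. Then $T$ can be written uniquely as $T=T_0+T_1$ where $\mathcal P_\mu(T_0)=\mathcal P^o_\mu(T_0)=T_0$ and $\mathcal P_\mu(T_1)=\mathcal P^o_\mu(T_1)=-T_1$.
   Context: $\lambda$ and $\rho$ denote the left and right regular representations of $\Gamma$ on $\ell^2(\Gamma)$: $\lambda_g\delta_x=\delta_{gx}$, $\rho_g\delta_x=\delta_{xg^{-1}}$. Define on $\mathcal B(\ell^2(\Gamma))$: $\mathcal P_\mu(T)=\sum_g\mu(g)\rho_gT\rho_g^*$ and $\mathcal P^o_\mu(T)=\sum_g\mu(g)\lambda_g^*T\lambda_g$. $\mu$ symmetric means $\mu(g)=\mu(g^{-1})$ for all $g$. *)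

theory Defs
  imports "HOL-Analysis.Analysis"
begin

text \<open>The group \<Gamma> is a type of class group_add (written additively, not
necessarily commutative) and countable.  Vectors of l^2(\<Gamma>) are square-summable
functions; operators are functions on functions, considered only on l^2.\<close>

definition l2 :: "('g \<Rightarrow> complex) set" where
  "l2 = {f. (\<lambda>x. (cmod (f x))\<^sup>2) summable_on UNIV}"

definition l2norm :: "('g \<Rightarrow> complex) \<Rightarrow> real" where
  "l2norm f = sqrt (\<Sum>\<^sub>\<infinity>x. (cmod (f x))\<^sup>2)"

type_synonym 'g op = "('g \<Rightarrow> complex) \<Rightarrow> ('g \<Rightarrow> complex)"

definition bounded_op :: "'g op \<Rightarrow> bool" where
  "bounded_op T \<longleftrightarrow>
     (\<forall>f\<in>l2. T f \<in> l2) \<and>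
     (\<forall>f\<in>l2. \<forall>g\<in>l2. \<forall>a b::complex. T (\<lambda>x. a * f x + b * g x) = (\<lambda>x. a * T f x + b * T g x)) \<and>
     (\<exists>C. \<forall>f\<in>l2. l2norm (T f) \<le> C * l2norm f)"

definition op_eq :: "'g op \<Rightarrow> 'g op \<Rightarrow> bool" where
  "op_eq S T \<longleftrightarrow> (\<forall>f\<in>l2. S f = T f)"

definition op_add :: "'g op \<Rightarrow> 'g op \<Rightarrow> 'g op" where
  "op_add S T = (\<lambda>f x. S f x + T f x)"

definition op_neg :: "'g op \<Rightarrow> 'g op" where
  "op_neg T = (\<lambda>f x. - T f x)"

definition lreg :: "'g::group_add \<Rightarrow> ('g \<Rightarrow> complex) \<Rightarrow> ('g \<Rightarrow> complex)" where
  "lreg g f = (\<lambda>y. f (- g + y))"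

definition lreg_adj :: "'g::group_add \<Rightarrow> ('g \<Rightarrow> complex) \<Rightarrow> ('g \<Rightarrow> complex)" where
  "lreg_adj g f = (\<lambda>y. f (g + y))"

definition rreg :: "'g::group_add \<Rightarrow> ('g \<Rightarrow> complex) \<Rightarrow> ('g \<Rightarrow> complex)" where
  "rreg g f = (\<lambda>y. f (y + g))"

definition rreg_adj :: "'g::group_add \<Rightarrow> ('g \<Rightarrow> complex) \<Rightarrow> ('g \<Rightarrow> complex)" where
  "rreg_adj g f = (\<lambda>y. f (y - g))"

text \<open>P_\<mu>(T) = \<Sum>_g \<mu>(g) \<rho>_g T \<rho>_g^*, P^o_\<mu>(T) = \<Sum>_g \<mu>(g) \<lambda>_g^* T \<lambda>_g
  (the norm-convergent series, evaluated pointwise).\<close>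
definition P_mu :: "('g::group_add \<Rightarrow> real) \<Rightarrow> 'g op \<Rightarrow> 'g op" where
  "P_mu \<mu> T = (\<lambda>f y. \<Sum>\<^sub>\<infinity>g. complex_of_real (\<mu> g) * rreg g (T (rreg_adj g f)) y)"

definition Po_mu :: "('g::group_add \<Rightarrow> real) \<Rightarrow> 'g op \<Rightarrow> 'g op" where
  "Po_mu \<mu> T = (\<lambda>f y. \<Sum>\<^sub>\<infinity>g. complex_of_real (\<mu> g) * lreg_adj g (T (lreg g f)) y)"

definition symmetric_prob :: "('g::group_add \<Rightarrow> real) \<Rightarrow> bool" where
  "symmetric_prob \<mu> \<longleftrightarrow> (\<forall>g. \<mu> g \<ge> 0) \<and> (\<mu> has_sum 1) UNIV \<and> (\<forall>g. \<mu> (- g) = \<mu> g)"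

end

theory Submission
  imports Defs
begin

text \<open>It suffices to show \<open>P\<^sup>2 T = T\<close> for \<open>P = P_mu \<mu>\<close>: with \<open>Q = Po_mu \<mu>\<close>, the relation \<open>P Q T = T\<close> and
  the commutation of \<open>P\<close> and \<open>Q\<close> then give \<open>Q T = Q P\<^sup>2 T = P T\<close>, so that \<open>T0 = (T + P T) / 2\<close> and
  \<open>T1 = (T - P T) / 2\<close> work, and these formulas are forced.

  Viewed on matrix entries \<open>(f, y) \<mapsto> T f y\<close>, both \<open>P\<close> and \<open>Q\<close> are Markov operators, averaging over
  two commuting actions of the group. Let \<open>F\<close> be a real bounded function with \<open>P Q F = F\<close>, put
  \<open>D = P\<^sup>2 F - F\<close> and \<open>s = sup D\<close>. Then \<open>P\<^sup>2 Q\<^sup>2 D = D\<close>. As \<open>\<mu>\<close> is symmetric, two steps of \<open>Q\<close> return to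
  the starting point with some probability \<open>c > 0\<close>, so \<open>Q\<^sup>2 D \<le> c D + (1 - c) s\<close> and hence
  \<open>c (s - P\<^sup>2 D) \<le> s - D\<close>. Iterating, a point where \<open>D\<close> is close to \<open>s\<close> is one where
  \<open>D, P\<^sup>2 D, P\<^sup>4 D, \<dots>\<close> are all close to \<open>s\<close>, while the sums of these functions telescope and are
  bounded by \<open>2 sup |F|\<close>. Therefore \<open>s \<le> 0\<close>.\<close>

section \<open>Means of bounded functions under a probability weight\<close>

locale prob_weight =
  fixes \<mu> :: "'g \<Rightarrow> real"
  assumes nonneg: "\<mu> g \<ge> 0" and total: "(\<mu> has_sum 1) UNIV"
begin

text \<open>Real weights acting by \<open>scaleR\<close> let one set of lemmas serve both the real
  functions of the maximum argument and the complex matrix entries.\<close>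

definition wmean :: "('g \<Rightarrow> 'b::banach) \<Rightarrow> 'b" where
  "wmean \<phi> = (\<Sum>\<^sub>\<infinity>g. \<mu> g *\<^sub>R \<phi> g)"

lemma weight_summable: "\<mu> summable_on UNIV"
  using total by (rule has_sum_imp_summable)

lemma wmean_abs_summable:
  fixes \<phi> :: "'g \<Rightarrow> 'b::banach"
  assumes "bounded (range \<phi>)"
  shows "(\<lambda>g. norm (\<mu> g *\<^sub>R \<phi> g)) summable_on UNIV"
proof -
  obtain M where M: "\<And>g. norm (\<phi> g) \<le> M"
    using assms unfolding bounded_iff by auto
  show ?thesis
    by (rule Infinite_Sum.abs_summable_on_comparison_test'[where g = "\<lambda>g. \<mu> g * M"])
       (use M nonneg in \<open>auto intro!: summable_on_cmult_left weight_summable mult_left_mono\<close>)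
qed

lemma wmean_summable:
  fixes \<phi> :: "'g \<Rightarrow> 'b::banach"
  assumes "bounded (range \<phi>)"
  shows "(\<lambda>g. \<mu> g *\<^sub>R \<phi> g) summable_on UNIV"
  using wmean_abs_summable[OF assms] by (rule Infinite_Sum.abs_summable_summable)

lemma wmean_const [simp]: "wmean (\<lambda>_. c) = c"
  using has_sum_bounded_linear[OF bounded_linear_scaleR_left[of c] total]
  by (simp add: wmean_def infsumI)

lemma wmean_add:
  assumes "bounded (range \<phi>)" "bounded (range \<psi>)"
  shows "wmean (\<lambda>g. \<phi> g + \<psi> g) = wmean \<phi> + wmean \<psi>"
  using assms by (simp add: wmean_def scaleR_add_right infsum_add wmean_summable)

lemma wmean_linear:
  assumes "bounded_linear h" "bounded (range \<phi>)"
  shows "wmean (\<lambda>g. h (\<phi> g)) = h (wmean \<phi>)"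
proof -
  interpret bounded_linear h by fact
  show ?thesis
    using has_sum_bounded_linear[OF assms(1) has_sum_infsum[OF wmean_summable[OF assms(2)]]]
    by (simp add: wmean_def scaleR infsumI)
qed

lemma wmean_minus:
  assumes "bounded (range \<phi>)"
  shows "wmean (\<lambda>g. - \<phi> g) = - wmean \<phi>"
  using wmean_linear[OF bounded_linear_minus[OF bounded_linear_ident] assms] .

lemma wmean_diff:
  assumes "bounded (range \<phi>)" "bounded (range \<psi>)"
  shows "wmean (\<lambda>g. \<phi> g - \<psi> g) = wmean \<phi> - wmean \<psi>"
proof -
  have "bounded (range (\<lambda>g. - \<psi> g))"
    using assms(2) by (simp add: bounded_iff)
  from wmean_add[OF assms(1) this] show ?thesis
    using assms(2) by (simp add: wmean_minus)
qed

lemma wmean_mono: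
  fixes \<phi> :: "'g \<Rightarrow> real"
  assumes "bounded (range \<phi>)" "bounded (range \<psi>)" "\<And>g. \<phi> g \<le> \<psi> g"
  shows "wmean \<phi> \<le> wmean \<psi>"
  unfolding wmean_def using assms nonneg
  by (intro infsum_mono wmean_summable) (auto intro: mult_left_mono)

lemma wmean_sum:
  fixes \<phi> :: "'i \<Rightarrow> 'g \<Rightarrow> 'b::banach"
  assumes "finite I" "\<And>i. bounded (range (\<phi> i))"
  shows "wmean (\<lambda>g. \<Sum>i\<in>I. \<phi> i g) = (\<Sum>i\<in>I. wmean (\<phi> i))"
  using assms(1)
proof (induction I)
  case (insert i I)
  have "bounded (range (\<lambda>g. \<Sum>i\<in>I. \<phi> i g))"
    using insert.hyps(1) by (induction I) (simp_all add: bounded_plus_comp assms(2))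
  with insert show ?case by (simp add: wmean_add assms(2))
qed simp

lemma norm_wmean_le:
  fixes \<phi> :: "'g \<Rightarrow> 'b::banach"
  assumes "bounded (range \<phi>)"
  shows "norm (wmean \<phi>) \<le> wmean (\<lambda>g. norm (\<phi> g))"
  unfolding wmean_def using norm_infsum_bound[OF wmean_abs_summable[OF assms]] nonneg by simp

lemma bounded_wmean:
  fixes \<phi> :: "'x \<Rightarrow> 'g \<Rightarrow> 'b::banach"
  assumes "\<And>x g. norm (\<phi> x g) \<le> M"
  shows "bounded (range (\<lambda>x. wmean (\<phi> x)))"
proof -
  have b: "bounded (range (\<phi> x))" "bounded (range (\<lambda>g. norm (\<phi> x g)))" for x
    using assms by (auto simp: bounded_iff)
  have "wmean (\<lambda>g. norm (\<phi> x g)) \<le> M" for x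
    using wmean_mono[OF b(2)[of x], of "\<lambda>_. M"] assms by simp
  then show ?thesis
    using norm_wmean_le[OF b(1)] unfolding bounded_iff by (blast intro: order_trans)
qed

text \<open>Fubini for the product weight: the uniform bound \<open>M\<close> dominates the double
  family by \<open>M * (\<mu> g * \<mu> h)\<close>, which is summable over pairs.\<close>

lemma wmean_swap:
  fixes \<phi> :: "'g \<Rightarrow> 'g \<Rightarrow> 'b::banach"
  assumes "\<And>g h. norm (\<phi> g h) \<le> M"
  shows "wmean (\<lambda>g. wmean (\<phi> g)) = wmean (\<lambda>h. wmean (\<lambda>g. \<phi> g h))"
proof -
  have M: "M \<ge> 0" using assms[of undefined undefined] norm_ge_zero order_trans by blast
  have "(\<lambda>x. norm (case x of (g, h) \<Rightarrow> \<mu> g *\<^sub>R \<mu> h *\<^sub>R \<phi> g h)) summable_on UNIV \<times> UNIV"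
  proof (rule Infinite_Sum.abs_summable_on_comparison_test[where g = "\<lambda>(g, h). M * (\<mu> g * \<mu> h)"])
    have 1: "(\<lambda>h. M * (\<mu> g * \<mu> h)) summable_on UNIV" for g
      by (intro summable_on_cmult_right weight_summable)
    have 2: "(\<Sum>\<^sub>\<infinity>h. M * (\<mu> g * \<mu> h)) = M * \<mu> g" for g
      using infsumI[OF total] by (simp add: infsum_cmult_right' mult.assoc)
    show "(\<lambda>x. norm (case x of (g, h) \<Rightarrow> M * (\<mu> g * \<mu> h))) summable_on UNIV \<times> UNIV"
      unfolding Infinite_Sum.abs_summable_on_Sigma_iff using M nonneg 1 2
      by (auto simp: abs_mult summable_on_cmult_right weight_summable)
  next
    show "norm (case x of (g, h) \<Rightarrow> \<mu> g *\<^sub>R \<mu> h *\<^sub>R \<phi> g h)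
        \<le> norm (case x of (g, h) \<Rightarrow> M * (\<mu> g * \<mu> h))" for x
      using mult_right_mono[OF assms, of "\<mu> (fst x) * \<mu> (snd x)"] M nonneg
      by (simp add: split_beta abs_mult mult_ac)
  qed
  then have "(\<lambda>(g, h). \<mu> g *\<^sub>R \<mu> h *\<^sub>R \<phi> g h) summable_on UNIV \<times> UNIV"
    by (rule Infinite_Sum.abs_summable_summable)
  from infsum_swap_banach[OF this] show ?thesis
    unfolding wmean_def by (simp add: infsum_scaleR_right[symmetric] mult.commute)
qed

text \<open>Jensen for the square: with \<open>m\<close> the mean, the tangent
  \<open>2 * m * \<phi> g - m\<^sup>2\<close> lies below \<open>(\<phi> g)\<^sup>2\<close> and has
  mean \<open>m\<^sup>2\<close>.\<close>

lemma wmean_square_le: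
  fixes \<phi> :: "'g \<Rightarrow> real"
  assumes "bounded (range \<phi>)"
  shows "(wmean \<phi>)\<^sup>2 \<le> wmean (\<lambda>g. (\<phi> g)\<^sup>2)"
proof -
  define m where "m = wmean \<phi>"
  obtain M where M: "\<And>g. \<bar>\<phi> g\<bar> \<le> M" using assms unfolding bounded_iff by auto
  have b2: "bounded (range (\<lambda>g. (\<phi> g)\<^sup>2))"
    unfolding bounded_iff by (intro exI[of _ "M\<^sup>2"]) (use power_mono[OF M abs_ge_zero, of _ 2] in auto)
  have b1: "bounded (range (\<lambda>g. 2 * m * \<phi> g))"
    unfolding bounded_iff
    by (intro exI[of _ "\<bar>2 * m\<bar> * M"]) (auto simp: abs_mult M mult_left_mono)
  have bc: "bounded (range (\<lambda>g::'g. m\<^sup>2))" by (auto simp: bounded_iff)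
  have "wmean (\<lambda>g. 2 * m * \<phi> g - m\<^sup>2) \<le> wmean (\<lambda>g. (\<phi> g)\<^sup>2)"
  proof (rule wmean_mono[OF bounded_minus_comp[OF b1 bc] b2])
    show "2 * m * \<phi> g - m\<^sup>2 \<le> (\<phi> g)\<^sup>2" for g
      using zero_le_power2[of "\<phi> g - m"] by (simp add: power2_eq_square algebra_simps)
  qed
  moreover have "wmean (\<lambda>g. 2 * m * \<phi> g) = 2 * m * m"
    using wmean_linear[OF bounded_linear_mult_right assms] by (simp add: m_def)
  ultimately show ?thesis
    using wmean_diff[OF b1 bc] by (simp add: m_def power2_eq_square)
qed

section \<open>Markov operators given by families of maps\<close>

definition avg :: "('g \<Rightarrow> 'x \<Rightarrow> 'x) \<Rightarrow> ('x \<Rightarrow> 'b::banach) \<Rightarrow> 'x \<Rightarrow> 'b" where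
  "avg a F x = wmean (\<lambda>g. F (a g x))"

lemma bounded_orbit:
  assumes "bounded (range F)"
  shows "bounded (range (\<lambda>g. F (a g x)))"
  using assms by (rule bounded_subset) auto

lemma bounded_avg:
  fixes F :: "'x \<Rightarrow> 'b::banach"
  assumes "bounded (range F)"
  shows "bounded (range (avg a F))"
proof -
  obtain M where "\<And>x. norm (F x) \<le> M" using assms unfolding bounded_iff by auto
  then show ?thesis unfolding avg_def [abs_def] by (intro bounded_wmean)
qed

lemma avg_add:
  assumes "bounded (range F)" "bounded (range G)"
  shows "avg a (\<lambda>x. F x + G x) = (\<lambda>x. avg a F x + avg a G x)"
  unfolding avg_def using assms by (simp add: wmean_add bounded_orbit)

lemma avg_diff:
  assumes "bounded (range F)" "bounded (range G)"
  shows "avg a (\<lambda>x. F x - G x) = (\<lambda>x. avg a F x - avg a G x)"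
  unfolding avg_def using assms by (simp add: wmean_diff bounded_orbit)

lemma avg_linear:
  assumes "bounded_linear h" "bounded (range F)"
  shows "avg a (\<lambda>x. h (F x)) = (\<lambda>x. h (avg a F x))"
  using wmean_linear[OF assms(1) bounded_orbit[OF assms(2), of a]] by (simp add: avg_def fun_eq_iff)

lemma avg_mono:
  fixes F :: "'x \<Rightarrow> real"
  assumes "bounded (range F)" "bounded (range G)" "\<And>x. F x \<le> G x"
  shows "avg a F x \<le> avg a G x"
  unfolding avg_def
  by (rule wmean_mono[OF bounded_orbit[OF assms(1), of a] bounded_orbit[OF assms(2), of a] assms(3)])

lemma avg_le:
  fixes F :: "'x \<Rightarrow> real"
  assumes "bounded (range F)" "\<And>x. F x \<le> s"
  shows "avg a F x \<le> s"
  using wmean_mono[OF bounded_orbit[OF assms(1), of a x], of "\<lambda>_. s"] assms(2) by (simp add: avg_def)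

text \<open>Both sides average \<open>F\<close> over the same two-step endpoints, only in the
  opposite order of summation, which \<open>wmean_swap\<close> exchanges.\<close>

lemma avg_commute:
  fixes F :: "'x \<Rightarrow> 'b::banach"
  assumes "bounded (range F)" "\<And>g h x. a g (b h x) = b h (a g x)"
  shows "avg a (avg b F) = avg b (avg a F)"
proof
  fix x
  obtain M where "\<And>x. norm (F x) \<le> M" using assms unfolding bounded_iff by auto
  then show "avg a (avg b F) x = avg b (avg a F) x"
    unfolding avg_def assms(2)[symmetric] by (rule wmean_swap)
qed

section \<open>Return probabilities and the maximum argument\<close>

lemma weight_pos: obtains g where "\<mu> g > 0"
proof (rule ccontr)
  assume "\<not> thesis"
  with that nonneg have "\<mu> = (\<lambda>_. 0)" by (intro ext) (meson antisym not_le)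
  with infsumI[OF total] show False by simp
qed

text \<open>The mean of the nonnegative function \<open>s - F\<close> is at least its single term at
  \<open>g\<close>.\<close>

lemma avg_le_atom:
  fixes F :: "'x \<Rightarrow> real"
  assumes "bounded (range F)" "\<And>x. F x \<le> s"
  shows "avg a F x \<le> \<mu> g * F (a g x) + (1 - \<mu> g) * s"
proof -
  have b: "bounded (range (\<lambda>h. s - F (a h x)))"
    using bounded_minus_comp[of "\<lambda>_. s" UNIV, OF _ bounded_orbit[OF assms(1), of a x]] by simp
  have "\<mu> g * (s - F (a g x)) \<le> wmean (\<lambda>h. s - F (a h x))"
    using finite_sum_le_infsum[OF wmean_summable[OF b], of "{g}"] assms(2) nonneg
    by (simp add: wmean_def)
  also have "\<dots> = s - avg a F x"
    using wmean_diff[of "\<lambda>_. s", OF _ bounded_orbit[OF assms(1), of a x]] by (simp add: avg_def)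
  finally show ?thesis by (simp add: algebra_simps)
qed

text \<open>The step \<open>g\<close> followed by the step \<open>h\<close> leads back to
  \<open>x\<close> and has probability \<open>(\<mu> g)\<^sup>2\<close>; all other two-step paths
  contribute at most \<open>s\<close>. This is \<open>avg_le_atom\<close> used once per
  step.\<close>

lemma avg_avg_le_return:
  fixes E :: "'x \<Rightarrow> real"
  assumes "bounded (range E)" "\<And>x. E x \<le> s" "a h (a g x) = x" "\<mu> h = \<mu> g"
  shows "avg a (avg a E) x \<le> (\<mu> g)\<^sup>2 * E x + (1 - (\<mu> g)\<^sup>2) * s"
proof -
  have "avg a (avg a E) x \<le> \<mu> g * avg a E (a g x) + (1 - \<mu> g) * s"
    by (intro avg_le_atom bounded_avg avg_le assms(1,2))
  also have "\<mu> g * avg a E (a g x) \<le> \<mu> g * (\<mu> g * E x + (1 - \<mu> g) * s)"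
    using avg_le_atom[OF assms(1,2), of a "a g x" h] assms(3,4) nonneg
    by (intro mult_left_mono) simp_all
  finally show ?thesis
    by (simp add: power2_eq_square algebra_simps)
qed

text \<open>The estimate behind the Choquet--Deny argument: since \<open>b\<close> returns to its starting point
  with positive probability, a near maximum of a function fixed by \<open>(avg a)\<^sup>2 (avg b)\<^sup>2\<close> is also a
  near maximum of its \<open>(avg a)\<^sup>2\<close>-average.\<close>
lemma near_max_avg:
  fixes E :: "'x \<Rightarrow> real"
  assumes bdd: "bounded (range E)" and le: "\<And>x. E x \<le> s"
    and fixed: "avg a (avg a (avg b (avg b E))) = E"
    and inv: "\<And>x. b h (b g x) = x" "\<mu> h = \<mu> g"
  shows "(\<mu> g)\<^sup>2 * (s - avg a (avg a E) x) \<le> s - E x"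
proof -
  define c where "c = (\<mu> g)\<^sup>2"
  \<comment> \<open>\<open>G\<close> is the bound that \<open>avg_avg_le_return\<close> gives for
    \<open>avg b (avg b E)\<close>; averaging it over \<open>a\<close> acts on the \<open>E\<close>
    term and leaves the constant alone.\<close>
  define G where "G = (\<lambda>x. c * E x + (1 - c) * s)"
  have lin: "bounded_linear (\<lambda>r. c * r)" by (rule bounded_linear_mult_right)
  have bc: "bounded (range (\<lambda>x::'x. (1 - c) * s))" by simp
  have avg_const: "avg a (\<lambda>x. (1 - c) * s) = (\<lambda>x. (1 - c) * s)" by (simp add: avg_def fun_eq_iff)
  have avg_G: "avg a (\<lambda>x. c * H x + (1 - c) * s) = (\<lambda>x. c * avg a H x + (1 - c) * s)"
    if "bounded (range H)" for H :: "'x \<Rightarrow> real"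
    using avg_add[OF bounded_linear_image[OF that lin, unfolded image_image] bc, of a]
      avg_linear[OF lin that, of a] avg_const by simp
  have bG: "bounded (range G)"
    unfolding G_def
    using bounded_plus_comp[OF bounded_linear_image[OF bdd lin, unfolded image_image] bc] .
  have "E x = avg a (avg a (avg b (avg b E))) x" by (simp add: fixed)
  also have "\<dots> \<le> avg a (avg a G) x"
  proof (rule avg_mono[OF bounded_avg bounded_avg], goal_cases)
    case (3 y)
    have "avg b (avg b E) z \<le> G z" for z
      using avg_avg_le_return[of E s b h g z, OF bdd le inv] by (simp add: G_def c_def)
    with bounded_avg[OF bounded_avg[OF bdd, of b], of b] bG show ?case by (rule avg_mono)
  qed (intro bounded_avg bdd bG)+
  also have "\<dots> = c * avg a (avg a E) x + (1 - c) * s"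
    unfolding G_def by (simp add: avg_G bdd bounded_avg)
  finally show ?thesis by (simp add: c_def algebra_simps)
qed

text \<open>The inequality is one-sided because the argument controls a supremum;
  \<open>avg_avg_eq_self\<close> later upgrades it to an equality. The map \<open>\<iota>\<close>
  stands for inversion in the group.\<close>

lemma avg_avg_le_self:
  fixes F :: "'x \<Rightarrow> real"
  assumes bdd: "bounded (range F)"
    and fixed: "avg a (avg b F) = F"
    and comm: "\<And>g h x. a g (b h x) = b h (a g x)"
    and inv: "\<And>g x. b (\<iota> g) (b g x) = x" "\<And>g. \<mu> (\<iota> g) = \<mu> g"
  shows "avg a (avg a F) x \<le> F x"
proof -
  define A where "A G = avg a (avg a G)" for G :: "'x \<Rightarrow> real"
  define B where "B G = avg b (avg b G)" for G :: "'x \<Rightarrow> real"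
  define D where "D = (\<lambda>x. A F x - F x)"
  define E where "E k = (A ^^ k) D" for k
  have bA: "bounded (range (A G))" if "bounded (range G)" for G
    using that by (simp add: A_def bounded_avg)
  have A_le: "A G x \<le> r" if "bounded (range G)" "\<And>x. G x \<le> r" for G r x
    unfolding A_def by (intro avg_le bounded_avg that)
  have swap: "avg a (avg b G) = avg b (avg a G)" if "bounded (range G)" for G :: "'x \<Rightarrow> real"
    using that comm by (rule avg_commute)
  \<comment> \<open>Moving one \<open>a\<close> past one \<open>b\<close> turns
    \<open>a a b b\<close> into \<open>a b a b\<close>, and each pair \<open>a b\<close> fixes
    \<open>F\<close>.\<close>
  have AB: "A (B F) = F"
    using swap[OF bounded_avg[OF bdd, of b]] by (simp add: A_def B_def fixed)
  have ABA: "A (B (A G)) = A (A (B G))" if "bounded (range G)" for G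
    using that by (simp add: A_def B_def swap bounded_avg)
  have A_diff: "A (\<lambda>x. G x - H x) = (\<lambda>x. A G x - A H x)"
    if "bounded (range G)" "bounded (range H)" for G H
    using that by (simp add: A_def avg_diff bounded_avg)
  have B_diff: "B (\<lambda>x. G x - H x) = (\<lambda>x. B G x - B H x)"
    if "bounded (range G)" "bounded (range H)" for G H
    using that by (simp add: B_def avg_diff bounded_avg)
  have bB: "bounded (range (B G))" if "bounded (range G)" for G
    using that by (simp add: B_def bounded_avg)
  have bD: "bounded (range D)"
    unfolding D_def by (intro bounded_minus_comp bA bdd)
  have bE: "bounded (range (E k))" for k
    by (induction k) (simp_all add: E_def bD bA)
  \<comment> \<open>Both \<open>F\<close> and \<open>A F\<close> are fixed by \<open>A\<close> after
    \<open>B\<close>, the latter because this composite commutes with \<open>A\<close>.\<close>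
  have AB_D: "A (B D) = D"
    unfolding D_def by (simp add: A_diff B_diff ABA AB bA bB bdd)
  have AB_E: "A (B (E k)) = E k" for k
    by (induction k) (use bE in \<open>simp_all add: E_def AB_D ABA\<close>)
  define s where "s = (SUP x. D x)"
  have D_le: "D x \<le> s" for x
    unfolding s_def using bD by (intro cSUP_upper bounded_imp_bdd_above) auto
  have E_le: "E k x \<le> s" for k x
  proof (induction k arbitrary: x)
    case (Suc k)
    with A_le[OF bE] show ?case by (simp add: E_def)
  qed (simp add: E_def D_le)
  obtain g where g: "\<mu> g > 0" by (rule weight_pos)
  define c where "c = (\<mu> g)\<^sup>2"
  have c: "c > 0" using g by (simp add: c_def)
  \<comment> \<open>Each application of \<open>near_max_avg\<close> to the next \<open>E k\<close>
    costs one factor \<open>c\<close>.\<close>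
  have near: "c ^ k * (s - E k x) \<le> s - D x" for k x
  proof (induction k)
    case (Suc k)
    have "c * (s - E (Suc k) x) \<le> s - E k x"
      using near_max_avg[OF bE E_le, of a b k "\<iota> g" g x] AB_E[of k] inv
      by (simp add: A_def B_def E_def c_def)
    then have "c ^ k * (c * (s - E (Suc k) x)) \<le> c ^ k * (s - E k x)"
      using c by simp
    with Suc show ?case by (simp add: mult_ac)
  qed (simp add: E_def)
  have telescope: "(\<Sum>k<n. E k x) = (A ^^ n) F x - F x" for n x
  proof (induction n)
    case (Suc n)
    have bn: "bounded (range ((A ^^ n) F))" for n
      by (induction n) (simp_all add: bdd bA)
    have "E n = (\<lambda>x. (A ^^ Suc n) F x - (A ^^ n) F x)"
    proof (induction n)
      case (Suc n)
      have "E (Suc n) = A (E n)" by (simp add: E_def)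
      also have "\<dots> = (\<lambda>x. A ((A ^^ Suc n) F) x - A ((A ^^ n) F) x)"
        unfolding Suc by (rule A_diff[OF bn bn])
      finally show ?case by simp
    qed (simp add: E_def D_def)
    with Suc show ?case by simp
  qed simp
  obtain M where M: "\<And>x. \<bar>F x\<bar> \<le> M" using bdd unfolding bounded_iff by auto
  have A_pow_le: "(A ^^ n) F x \<le> M" for n x
  proof (induction n arbitrary: x)
    case (Suc n)
    have "bounded (range ((A ^^ n) F))"
      by (induction n) (simp_all add: bdd bA)
    from A_le[OF this Suc] show ?case by simp
  qed (use M abs_le_D1 in auto)
  \<comment> \<open>The supremum \<open>s\<close> need not be attained, so for fixed
    \<open>n\<close> a point nearly attaining it is used, with total error at most
    \<open>e\<close>.\<close>
  have "real n * s \<le> 2 * M" for n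
  proof (rule field_le_epsilon)
    fix e :: real assume e: "e > 0"
    \<comment> \<open>By \<open>near\<close>, \<open>E k x\<close> falls short of \<open>s\<close>
      by at most \<open>(s - D x) / c ^ k\<close>; \<open>K\<close> collects these factors over all
      \<open>k < n\<close>.\<close>
    define K where "K = (\<Sum>k<n. 1 / c ^ k)"
    have K: "K \<ge> 0" using c by (auto simp: K_def intro: sum_nonneg)
    \<comment> \<open>Dividing by \<open>K + 1\<close> keeps the denominator positive also for
      \<open>n = 0\<close>, where \<open>K = 0\<close>, and still gives
      \<open>K * (e / (K + 1)) \<le> e\<close>.\<close>
    have "s - e / (K + 1) < s" using e K by simp
    then obtain x where x: "s - e / (K + 1) < D x"
      unfolding s_def using less_cSUP_iff[of UNIV D] bD bounded_imp_bdd_above by auto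
    have "real n * s - K * (s - D x) = (\<Sum>k<n. s - (s - D x) / c ^ k)"
      by (simp add: K_def sum_subtractf sum_distrib_right)
    also have "\<dots> \<le> (\<Sum>k<n. E k x)"
    proof (rule sum_mono)
      show "s - (s - D x) / c ^ k \<le> E k x" for k
        using near[of k x] c by (simp add: field_simps)
    qed
    also have "\<dots> \<le> 2 * M"
      using telescope[of x n] A_pow_le[of n x] M[of x] by linarith
    finally have "real n * s \<le> 2 * M + K * (s - D x)" by simp
    also have "K * (s - D x) \<le> K * (e / (K + 1))"
      using x K by (intro mult_left_mono) auto
    also have "\<dots> \<le> e" using K e by (simp add: field_simps)
    finally show "real n * s \<le> 2 * M + e" by simp
  qed
  \<comment> \<open>All multiples \<open>real n * s\<close> share one upper bound, which is
    impossible for positive \<open>s\<close>.\<close>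
  then have "s \<le> 0"
    using reals_Archimedean3[of s] by (metis not_le)
  with D_le[of x] show ?thesis by (simp add: D_def A_def)
qed

lemma avg_avg_eq_self:
  fixes F :: "'x \<Rightarrow> complex"
  assumes bdd: "bounded (range F)"
    and fixed: "avg a (avg b F) = F"
    and comm: "\<And>g h x. a g (b h x) = b h (a g x)"
    and inv: "\<And>g x. b (\<iota> g) (b g x) = x" "\<And>g. \<mu> (\<iota> g) = \<mu> g"
  shows "avg a (avg a F) = F"
proof
  fix x
  define z where "z = avg a (avg a F) x - F x"
  \<comment> \<open>The defect \<open>z\<close> is tested against itself: \<open>h z\<close> is the
    squared modulus of \<open>z\<close>, so the real inequality for \<open>h\<close> composed with
    \<open>F\<close> forces \<open>z = 0\<close>.\<close>
  define h where "h w = Re (cnj z * w)" for w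
  have h: "bounded_linear h"
    unfolding h_def
    by (intro bounded_linear_compose[OF bounded_linear_Re] bounded_linear_mult_right)
  interpret h: bounded_linear h by (rule h)
  have bh: "bounded (range (\<lambda>x. h (F x)))"
    using bounded_linear_image[OF bdd h] by (simp add: image_image)
  have "avg a (avg a (\<lambda>x. h (F x))) x \<le> h (F x)"
    by (rule avg_avg_le_self[of "\<lambda>x. h (F x)" a b \<iota> x, OF bh _ comm inv])
       (simp add: avg_linear[OF h] bdd bounded_avg fixed)
  then have "h z \<le> 0"
    by (simp add: avg_linear[OF h] bdd bounded_avg z_def h.diff)
  then have "(cmod z)\<^sup>2 \<le> 0"
    unfolding cmod_power2 h_def by (simp add: power2_eq_square)
  then show "avg a (avg a F) x = F x" by (simp add: z_def)
qed

lemma avg_eq_avg: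
  fixes F :: "'x \<Rightarrow> complex"
  assumes bdd: "bounded (range F)"
    and fixed: "avg a (avg b F) = F"
    and comm: "\<And>g h x. a g (b h x) = b h (a g x)"
    and inv: "\<And>g x. b (\<iota> g) (b g x) = x" "\<And>g. \<mu> (\<iota> g) = \<mu> g"
  shows "avg b F = avg a F"
proof -
  have "avg b F = avg b (avg a (avg a F))"
    using avg_avg_eq_self[of F a b \<iota>, OF assms] by simp
  also have "\<dots> = avg a (avg a (avg b F))"
    by (simp add: avg_commute[of _ a b, OF _ comm, symmetric] bdd bounded_avg)
  finally show ?thesis by (simp add: fixed)
qed

end

section \<open>Matrix entries of operators\<close>

text \<open>Restricting to vectors of a fixed norm makes the function attached to a bounded operator
  bounded; the restriction is invariant under translations, which are isometric.\<close>
definition op_fun :: "real \<Rightarrow> 'g op \<Rightarrow> ('g \<Rightarrow> complex) \<times> 'g \<Rightarrow> complex" where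
  "op_fun r T = (\<lambda>(f, y). if f \<in> l2 \<and> l2norm f = r then T f y else 0)"

text \<open>Every vector of \<open>l2\<close> lies on the sphere whose radius is its own norm, so
  the restrictions together determine the operator there; the value 0 elsewhere matches the
  indifference of \<open>op_eq\<close> outside \<open>l2\<close>.\<close>

lemma op_eq_iff_op_fun: "op_eq S T \<longleftrightarrow> (\<forall>r. op_fun r S = op_fun r T)"
proof
  assume R: "\<forall>r. op_fun r S = op_fun r T"
  have "S f y = T f y" if "f \<in> l2" for f y
    using fun_cong[OF R[rule_format, of "l2norm f"], of "(f, y)"] that by (simp add: op_fun_def)
  then show "op_eq S T" by (auto simp: op_eq_def)
qed (auto simp: op_eq_def op_fun_def)

lemma op_fun_add: "op_fun r (op_add S T) = (\<lambda>x. op_fun r S x + op_fun r T x)"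
  by (auto simp: op_fun_def op_add_def)

lemma op_fun_neg: "op_fun r (op_neg T) = (\<lambda>x. - op_fun r T x)"
  by (auto simp: op_fun_def op_neg_def)

section \<open>Estimates in \<open>l2\<close> and isometric translations\<close>

lemma l2norm_nonneg: "l2norm f \<ge> 0"
  by (simp add: l2norm_def infsum_nonneg)

lemma l2norm_square: "(l2norm f)\<^sup>2 = (\<Sum>\<^sub>\<infinity>x. (cmod (f x))\<^sup>2)"
  by (simp add: l2norm_def infsum_nonneg)

lemma sum_le_l2norm_square:
  assumes "f \<in> l2" "finite Y"
  shows "(\<Sum>y\<in>Y. (cmod (f y))\<^sup>2) \<le> (l2norm f)\<^sup>2"
  unfolding l2norm_square using assms by (intro finite_sum_le_infsum) (auto simp: l2_def)

lemma cmod_le_l2norm: "f \<in> l2 \<Longrightarrow> cmod (f y) \<le> l2norm f"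
  using sum_le_l2norm_square[of f "{y}"] by (intro power2_le_imp_le[OF _ l2norm_nonneg]) simp

lemma l2I:
  assumes "\<And>Y. finite Y \<Longrightarrow> (\<Sum>y\<in>Y. (cmod (f y))\<^sup>2) \<le> K\<^sup>2" "K \<ge> 0"
  shows "f \<in> l2" "l2norm f \<le> K"
proof -
  show f: "f \<in> l2"
    unfolding l2_def using assms(1)
    by (auto intro!: nonneg_bdd_above_summable_on bdd_aboveI2)
  have "(l2norm f)\<^sup>2 \<le> K\<^sup>2"
    unfolding l2norm_square using f assms(1)
    by (intro infsum_le_finite_sums) (auto simp: l2_def)
  then show "l2norm f \<le> K" using assms(2) by (rule power2_le_imp_le)
qed

lemma l2_bij:
  assumes "bij \<pi>"
  shows "(\<lambda>x. f (\<pi> x)) \<in> l2 \<longleftrightarrow> f \<in> l2" "l2norm (\<lambda>x. f (\<pi> x)) = l2norm f"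
  unfolding l2_def l2norm_def
  using summable_on_reindex_bij_betw[OF assms, of "\<lambda>x. (cmod (f x))\<^sup>2"]
    infsum_reindex_bij_betw[OF assms, of "\<lambda>x. (cmod (f x))\<^sup>2"] by auto

lemma bij_translations:
  fixes g :: "'g::group_add"
  shows "bij (\<lambda>y. g + y)" "bij (\<lambda>y. y + g)" "bij (\<lambda>y. y - g)"
  by (rule o_bij[of "\<lambda>y. - g + y"] o_bij[of "\<lambda>y. y - g"] o_bij[of "\<lambda>y. y + g"];
      simp add: fun_eq_iff add.assoc[symmetric]; simp add: add.assoc)+

lemmas l2_translations [simp] =
  l2_bij[OF bij_translations(1)] l2_bij[OF bij_translations(2)] l2_bij[OF bij_translations(3)]

lemma l2_regular [simp]:
  "lreg g f \<in> l2 \<longleftrightarrow> f \<in> l2" "l2norm (lreg g f) = l2norm f"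
  "rreg g f \<in> l2 \<longleftrightarrow> f \<in> l2" "l2norm (rreg g f) = l2norm f"
  "rreg_adj g f \<in> l2 \<longleftrightarrow> f \<in> l2" "l2norm (rreg_adj g f) = l2norm f"
  by (simp_all add: lreg_def rreg_def rreg_adj_def)

text \<open>\<open>bounded_op\<close> does not state the sign of its constant; as norms are
  nonnegative, \<open>max C 0\<close> also works.\<close>

lemma bounded_op_boundE:
  assumes "bounded_op T"
  obtains C where "C \<ge> 0" "\<And>f. f \<in> l2 \<Longrightarrow> l2norm (T f) \<le> C * l2norm f"
proof -
  obtain C where C: "\<And>f. f \<in> l2 \<Longrightarrow> l2norm (T f) \<le> C * l2norm f"
    using assms unfolding bounded_op_def by blast
  have "l2norm (T f) \<le> max C 0 * l2norm f" if "f \<in> l2" for f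
    using C[OF that] mult_right_mono[of C "max C 0" "l2norm f"] l2norm_nonneg[of f] by simp
  then show thesis using that[of "max C 0"] by simp
qed

lemma bounded_op_fun:
  assumes "bounded_op T"
  shows "bounded (range (op_fun r T))"
proof -
  obtain C where C: "C \<ge> 0" "\<And>f. f \<in> l2 \<Longrightarrow> l2norm (T f) \<le> C * l2norm f"
    using assms by (rule bounded_op_boundE) blast
  \<comment> \<open>The absolute value covers negative \<open>r\<close>, where no vector has norm
    \<open>r\<close> and \<open>op_fun\<close> vanishes.\<close>
  have "cmod (op_fun r T x) \<le> C * \<bar>r\<bar>" for x
  proof (cases x)
    case (Pair f y)
    show ?thesis
    proof (cases "f \<in> l2 \<and> l2norm f = r")
      case True
      then have "T f \<in> l2" using assms by (auto simp: bounded_op_def)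
      from cmod_le_l2norm[OF this, of y] C(2)[of f] True l2norm_nonneg[of f]
      show ?thesis by (simp add: Pair op_fun_def)
    qed (use C in \<open>auto simp: Pair op_fun_def\<close>)
  qed
  then show ?thesis by (auto simp: bounded_iff)
qed

text \<open>A crude substitute for the Minkowski inequality, based on
  \<open>(u + v)\<^sup>2 \<le> 2 * u\<^sup>2 + 2 * v\<^sup>2\<close>; the factor 2 is harmless since
  only boundedness is at stake.\<close>

lemma l2_combination:
  assumes "f \<in> l2" "g \<in> l2"
  shows "(\<lambda>x. a * f x + b * g x) \<in> l2"
    and "l2norm (\<lambda>x. a * f x + b * g x) \<le> 2 * (cmod a * l2norm f + cmod b * l2norm g)"
proof -
  have "(\<Sum>y\<in>Y. (cmod (a * f y + b * g y))\<^sup>2)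
      \<le> (2 * (cmod a * l2norm f + cmod b * l2norm g))\<^sup>2" if "finite Y" for Y
  proof -
    have "(cmod (a * f y + b * g y))\<^sup>2
        \<le> 2 * (cmod a)\<^sup>2 * (cmod (f y))\<^sup>2 + 2 * (cmod b)\<^sup>2 * (cmod (g y))\<^sup>2" for y
    proof -
      have "(cmod (a * f y + b * g y))\<^sup>2 \<le> (cmod a * cmod (f y) + cmod b * cmod (g y))\<^sup>2"
        by (intro power_mono) (metis norm_mult norm_triangle_ineq, simp)
      also have "\<dots> \<le> 2 * (cmod a)\<^sup>2 * (cmod (f y))\<^sup>2 + 2 * (cmod b)\<^sup>2 * (cmod (g y))\<^sup>2"
        using zero_le_power2[of "cmod a * cmod (f y) - cmod b * cmod (g y)"]
        by (simp add: power2_eq_square algebra_simps)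
      finally show ?thesis .
    qed
    then have "(\<Sum>y\<in>Y. (cmod (a * f y + b * g y))\<^sup>2)
        \<le> 2 * (cmod a)\<^sup>2 * (\<Sum>y\<in>Y. (cmod (f y))\<^sup>2) + 2 * (cmod b)\<^sup>2 * (\<Sum>y\<in>Y. (cmod (g y))\<^sup>2)"
      by (simp add: sum_distrib_left sum.distrib[symmetric] sum_mono)
    also have "\<dots> \<le> 2 * (cmod a)\<^sup>2 * (l2norm f)\<^sup>2 + 2 * (cmod b)\<^sup>2 * (l2norm g)\<^sup>2"
      by (intro add_mono mult_left_mono sum_le_l2norm_square assms that) auto
    also have "\<dots> \<le> (2 * (cmod a * l2norm f + cmod b * l2norm g))\<^sup>2"
    proof -
      have "0 \<le> (cmod a * l2norm f) * (cmod b * l2norm g)"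
        by (simp add: l2norm_nonneg)
      moreover have "0 \<le> (cmod a * l2norm f)\<^sup>2" "0 \<le> (cmod b * l2norm g)\<^sup>2" by simp_all
      ultimately show ?thesis
        unfolding power_mult_distrib power2_sum by (simp add: algebra_simps)
    qed
    finally show ?thesis .
  qed
  from l2I[OF this] show "(\<lambda>x. a * f x + b * g x) \<in> l2"
    "l2norm (\<lambda>x. a * f x + b * g x) \<le> 2 * (cmod a * l2norm f + cmod b * l2norm g)"
    by (simp_all add: l2norm_nonneg)
qed

lemma bounded_op_combination:
  assumes "bounded_op S" "bounded_op T"
  shows "bounded_op (\<lambda>f x. a * S f x + b * T f x)"
proof -
  obtain C where C: "C \<ge> 0" "\<And>f. f \<in> l2 \<Longrightarrow> l2norm (S f) \<le> C * l2norm f"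
    using assms(1) by (rule bounded_op_boundE) blast
  obtain D where D: "D \<ge> 0" "\<And>f. f \<in> l2 \<Longrightarrow> l2norm (T f) \<le> D * l2norm f"
    using assms(2) by (rule bounded_op_boundE) blast
  have ST: "S f \<in> l2" "T f \<in> l2" if "f \<in> l2" for f
    using assms that by (auto simp: bounded_op_def)
  have "l2norm (\<lambda>x. a * S f x + b * T f x) \<le> 2 * (cmod a * C + cmod b * D) * l2norm f"
    if f: "f \<in> l2" for f
  proof -
    have "2 * (cmod a * l2norm (S f) + cmod b * l2norm (T f))
        \<le> 2 * (cmod a * (C * l2norm f) + cmod b * (D * l2norm f))"
      by (intro mult_left_mono add_mono C D f) auto
    with l2_combination(2)[OF ST[OF f], of a b] show ?thesis by (simp add: algebra_simps)
  qed
  moreover have "a * S (\<lambda>x. c * f x + d * g x) y + b * T (\<lambda>x. c * f x + d * g x) y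
      = c * (a * S f y + b * T f y) + d * (a * S g y + b * T g y)"
    if "f \<in> l2" "g \<in> l2" for f g c d y
    using assms that by (simp add: bounded_op_def algebra_simps)
  ultimately show ?thesis
    unfolding bounded_op_def using l2_combination(1)[OF ST] by blast
qed

section \<open>Means of operators and translations of matrix entries\<close>

context prob_weight
begin

text \<open>Convexity of the norm: on a finite set \<open>Y\<close>, Jensen bounds each squared
  entry of the mean, and exchanging the finite sum with the mean leaves a mean of quantities at most
  \<open>K\<^sup>2\<close>.\<close>

lemma l2_wmean:
  fixes h :: "'g \<Rightarrow> 'x \<Rightarrow> complex"
  assumes "\<And>g. h g \<in> l2" "\<And>g. l2norm (h g) \<le> K"
  shows "(\<lambda>y. wmean (\<lambda>g. h g y)) \<in> l2" "l2norm (\<lambda>y. wmean (\<lambda>g. h g y)) \<le> K"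
proof -
  have K: "K \<ge> 0" using assms(2) l2norm_nonneg order_trans by blast
  have hK: "cmod (h g y) \<le> K" for g y
    using cmod_le_l2norm[OF assms(1)] assms(2) order_trans by blast
  have b: "bounded (range (\<lambda>g. h g y))" "bounded (range (\<lambda>g. cmod (h g y)))" for y
    using hK by (auto simp: bounded_iff)
  have b2: "bounded (range (\<lambda>g. (cmod (h g y))\<^sup>2))" for y
    using power_mono[OF hK, of _ _ 2] by (auto simp: bounded_iff)
  have "(\<Sum>y\<in>Y. (cmod (wmean (\<lambda>g. h g y)))\<^sup>2) \<le> K\<^sup>2" if Y: "finite Y" for Y
  proof -
    have le: "(\<Sum>y\<in>Y. (cmod (h g y))\<^sup>2) \<le> K\<^sup>2" for g
      using sum_le_l2norm_square[OF assms(1) Y] power_mono[OF assms(2) l2norm_nonneg, of _ 2]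
        order_trans by blast
    have bsum: "bounded (range (\<lambda>g. \<Sum>y\<in>Y. (cmod (h g y))\<^sup>2))"
      using le by (auto simp: bounded_iff sum_nonneg)
    have "(\<Sum>y\<in>Y. (cmod (wmean (\<lambda>g. h g y)))\<^sup>2) \<le> (\<Sum>y\<in>Y. wmean (\<lambda>g. (cmod (h g y))\<^sup>2))"
    proof (rule sum_mono)
      fix y
      have "(cmod (wmean (\<lambda>g. h g y)))\<^sup>2 \<le> (wmean (\<lambda>g. cmod (h g y)))\<^sup>2"
        by (intro power_mono norm_wmean_le b) simp
      also have "\<dots> \<le> wmean (\<lambda>g. (cmod (h g y))\<^sup>2)"
        by (rule wmean_square_le[OF b(2)])
      finally show "(cmod (wmean (\<lambda>g. h g y)))\<^sup>2 \<le> wmean (\<lambda>g. (cmod (h g y))\<^sup>2)" .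
    qed
    also have "\<dots> = wmean (\<lambda>g. \<Sum>y\<in>Y. (cmod (h g y))\<^sup>2)"
      using wmean_sum[OF Y b2] by simp
    also have "\<dots> \<le> K\<^sup>2"
      using wmean_mono[OF bsum, of "\<lambda>_. K\<^sup>2"] le by simp
    finally show ?thesis .
  qed
  note le = this
  show "(\<lambda>y. wmean (\<lambda>g. h g y)) \<in> l2" by (rule l2I(1)[OF le K])
  show "l2norm (\<lambda>y. wmean (\<lambda>g. h g y)) \<le> K" by (rule l2I(2)[OF le K])
qed

lemma bounded_op_wmean:
  fixes U :: "'g \<Rightarrow> 'x op"
  assumes op: "\<And>g. bounded_op (U g)"
    and bound: "\<And>g f. f \<in> l2 \<Longrightarrow> l2norm (U g f) \<le> C * l2norm f"
  shows "bounded_op (\<lambda>f y. wmean (\<lambda>g. U g f y))"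
proof -
  have l2: "U g f \<in> l2" if "f \<in> l2" for f g
    using op that by (auto simp: bounded_op_def)
  have b: "bounded (range (\<lambda>g. U g f y))" if "f \<in> l2" for f y
    using order_trans[OF cmod_le_l2norm[OF l2[OF that]] bound[OF that]]
    by (auto simp: bounded_iff)
  have lin: "wmean (\<lambda>g. U g (\<lambda>x. c * f x + d * k x) y)
      = c * wmean (\<lambda>g. U g f y) + d * wmean (\<lambda>g. U g k y)"
    if fk: "f \<in> l2" "k \<in> l2" for f k c d y
  proof -
    have bm: "bounded (range (\<lambda>g. c * U g f y))" if "f \<in> l2" for c f
      using bounded_linear_image[OF b[OF that] bounded_linear_mult_right] by (simp add: image_image)
    have "U g (\<lambda>x. c * f x + d * k x) y = c * U g f y + d * U g k y" for g
      using op[of g] fk by (simp add: bounded_op_def)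
    then show ?thesis
      using wmean_linear[OF bounded_linear_mult_right b] by (simp add: wmean_add bm fk)
  qed
  show ?thesis
    unfolding bounded_op_def
  proof (intro conjI ballI allI exI[of _ C])
    fix f :: "'x \<Rightarrow> complex" assume f: "f \<in> l2"
    note wm = l2_wmean[of "\<lambda>g. U g f" "C * l2norm f", OF l2[OF f] bound[OF f]]
    show "(\<lambda>y. wmean (\<lambda>g. U g f y)) \<in> l2" by (rule wm(1))
    show "l2norm (\<lambda>y. wmean (\<lambda>g. U g f y)) \<le> C * l2norm f" by (rule wm(2))
  qed (simp add: lin)
qed

end

text \<open>Made so that the term for \<open>g\<close> in \<open>P_mu \<mu> T\<close> at
  \<open>(f, y)\<close> is the entry of \<open>T\<close> at \<open>rshift g (f, y)\<close>;
  \<open>lshift\<close> does the same for \<open>Po_mu\<close>.\<close>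

definition rshift :: "'g::group_add \<Rightarrow> ('g \<Rightarrow> complex) \<times> 'g \<Rightarrow> ('g \<Rightarrow> complex) \<times> 'g" where
  "rshift g = (\<lambda>(f, y). (rreg_adj g f, y + g))"

definition lshift :: "'g::group_add \<Rightarrow> ('g \<Rightarrow> complex) \<times> 'g \<Rightarrow> ('g \<Rightarrow> complex) \<times> 'g" where
  "lshift g = (\<lambda>(f, y). (lreg g f, g + y))"

text \<open>Left and right translations commute by associativity, with no commutativity of the
  group.\<close>

lemma rshift_lshift: "rshift g (lshift h x) = lshift h (rshift g x)"
  by (cases x) (simp add: rshift_def lshift_def rreg_adj_def lreg_def fun_eq_iff
      add.assoc diff_conv_add_uminus del: add_uminus_conv_diff)

lemma lshift_uminus: "lshift (- g) (lshift g x) = x"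
  by (cases x) (simp add: lshift_def lreg_def fun_eq_iff add.assoc[symmetric])

context prob_weight
begin

text \<open>\<open>V g\<close> and \<open>W g\<close> preserve norms, so all conjugates obey the
  bound of \<open>T\<close> with one constant, as \<open>bounded_op_wmean\<close> requires.\<close>

lemma bounded_op_conjugate_mean:
  assumes T: "bounded_op T"
    and l2: "\<And>g f. V g f \<in> l2 \<longleftrightarrow> f \<in> l2" "\<And>g f. W g f \<in> l2 \<longleftrightarrow> f \<in> l2"
    and norm: "\<And>g f. l2norm (V g f) = l2norm f" "\<And>g f. l2norm (W g f) = l2norm f"
    and lin: "\<And>g f h a b. V g (\<lambda>x. a * f x + b * h x) = (\<lambda>x. a * V g f x + b * V g h x)"
      "\<And>g f h a b. W g (\<lambda>x. a * f x + b * h x) = (\<lambda>x. a * W g f x + b * W g h x)"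
  shows "bounded_op (\<lambda>f y. wmean (\<lambda>g. V g (T (W g f)) y))"
proof -
  obtain C where C: "\<And>f. f \<in> l2 \<Longrightarrow> l2norm (T f) \<le> C * l2norm f"
    using T by (rule bounded_op_boundE) blast
  have bound: "l2norm (V g (T (W g f))) \<le> C * l2norm f" if "f \<in> l2" for g f
    using C[of "W g f"] that by (simp add: l2 norm)
  have "bounded_op (\<lambda>f. V g (T (W g f)))" for g
    using T bound unfolding bounded_op_def by (auto simp: l2 lin)
  then show ?thesis
    by (rule bounded_op_wmean[of "\<lambda>g f. V g (T (W g f))" C]) (rule bound)
qed

end

section \<open>Existence and uniqueness of the splitting\<close>

locale symmetric_weight = prob_weight \<mu> for \<mu> :: "'g::group_add \<Rightarrow> real" +
  assumes symmetric: "\<mu> (- g) = \<mu> g"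
begin

lemma P_mu_eq_wmean: "P_mu \<mu> T = (\<lambda>f y. wmean (\<lambda>g. rreg g (T (rreg_adj g f)) y))"
  by (simp add: P_mu_def wmean_def scaleR_conv_of_real)

lemma Po_mu_eq_wmean: "Po_mu \<mu> T = (\<lambda>f y. wmean (\<lambda>g. lreg_adj g (T (lreg g f)) y))"
  by (simp add: Po_mu_def wmean_def scaleR_conv_of_real)

lemma bounded_op_P_mu: "bounded_op T \<Longrightarrow> bounded_op (P_mu \<mu> T)"
  unfolding P_mu_eq_wmean
  by (rule bounded_op_conjugate_mean[of T rreg rreg_adj]) (simp_all, simp_all add: rreg_def rreg_adj_def)

text \<open>Translations preserve \<open>l2\<close> and the norm, so the orbit of
  \<open>(f, y)\<close> stays on the sphere or stays off it; in the second case both sides are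
  0.\<close>

lemma op_fun_P_mu: "op_fun r (P_mu \<mu> T) = avg rshift (op_fun r T)"
  by (auto simp: fun_eq_iff op_fun_def P_mu_eq_wmean avg_def rshift_def rreg_def)

lemma op_fun_Po_mu: "op_fun r (Po_mu \<mu> T) = avg lshift (op_fun r T)"
  by (auto simp: fun_eq_iff op_fun_def Po_mu_eq_wmean avg_def lshift_def lreg_adj_def)

definition is_splitting :: "'g op \<Rightarrow> 'g op \<Rightarrow> 'g op \<Rightarrow> bool" where
  "is_splitting T T0 T1 \<longleftrightarrow> bounded_op T0 \<and> bounded_op T1 \<and> op_eq T (op_add T0 T1)
     \<and> op_eq (P_mu \<mu> T0) T0 \<and> op_eq (Po_mu \<mu> T0) T0
     \<and> op_eq (P_mu \<mu> T1) (op_neg T1) \<and> op_eq (Po_mu \<mu> T1) (op_neg T1)"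

text \<open>Applying \<open>P\<close> to \<open>T = T0 + T1\<close> gives
  \<open>P T = T0 - T1\<close>; the two equations are solved for \<open>T0\<close> and
  \<open>T1\<close>.\<close>

lemma splitting_formulas:
  assumes "is_splitting T T0 T1"
  shows "op_fun r T0 x = (op_fun r T x + avg rshift (op_fun r T) x) / 2"
    and "op_fun r T1 x = (op_fun r T x - avg rshift (op_fun r T) x) / 2"
proof -
  have b: "bounded (range (op_fun r T0))" "bounded (range (op_fun r T1))"
    using assms bounded_op_fun by (auto simp: is_splitting_def)
  have "op_fun r T = (\<lambda>x. op_fun r T0 x + op_fun r T1 x)"
    using assms by (simp add: is_splitting_def op_eq_iff_op_fun op_fun_add)
  moreover have "avg rshift (op_fun r T0) = op_fun r T0"
    and "avg rshift (op_fun r T1) = (\<lambda>x. - op_fun r T1 x)"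
    using assms by (simp_all add: is_splitting_def op_eq_iff_op_fun op_fun_neg op_fun_P_mu)
  ultimately show "op_fun r T0 x = (op_fun r T x + avg rshift (op_fun r T) x) / 2"
    "op_fun r T1 x = (op_fun r T x - avg rshift (op_fun r T) x) / 2"
    using avg_add[OF b] by simp_all
qed

lemma splitting_unique:
  assumes "is_splitting T T0 T1" "is_splitting T S0 S1"
  shows "op_eq T0 S0" "op_eq T1 S1"
  unfolding op_eq_iff_op_fun
  by (simp_all add: fun_eq_iff splitting_formulas[OF assms(1)] splitting_formulas[OF assms(2)])

lemma splitting_exists:
  assumes T: "bounded_op T" and fixed: "op_eq (P_mu \<mu> (Po_mu \<mu> T)) T"
  shows "\<exists>T0 T1. is_splitting T T0 T1"
proof -
  \<comment> \<open>The half-sum and half-difference forced by \<open>splitting_formulas\<close>,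
    written with explicit coefficients to fit \<open>bounded_op_combination\<close>.\<close>
  define T0 where "T0 = (\<lambda>f x. (1/2) * T f x + (1/2) * P_mu \<mu> T f x)"
  define T1 where "T1 = (\<lambda>f x. (1/2) * T f x + (-1/2) * P_mu \<mu> T f x)"
  have lin: "bounded_linear (\<lambda>z::complex. z / 2)" by (rule bounded_linear_divide)
  have T0_fun: "op_fun r T0 = (\<lambda>x. (op_fun r T x + op_fun r (P_mu \<mu> T) x) / 2)" for r
    by (auto simp: op_fun_def T0_def fun_eq_iff field_simps)
  have T1_fun: "op_fun r T1 = (\<lambda>x. (op_fun r T x - op_fun r (P_mu \<mu> T) x) / 2)" for r
    by (auto simp: op_fun_def T1_def fun_eq_iff field_simps)
  have b: "bounded (range (op_fun r T))" "bounded (range (op_fun r (P_mu \<mu> T)))" for r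
    using T by (auto intro: bounded_op_fun bounded_op_P_mu)
  have PPo: "avg rshift (avg lshift (op_fun r T)) = op_fun r T" for r
    using fixed by (simp add: op_eq_iff_op_fun op_fun_P_mu op_fun_Po_mu)
  have PP: "avg rshift (avg rshift (op_fun r T)) = op_fun r T" for r
    by (rule avg_avg_eq_self[of _ rshift lshift uminus, OF b(1) PPo rshift_lshift
          lshift_uminus symmetric])
  have Po: "avg lshift (op_fun r T) = avg rshift (op_fun r T)" for r
    by (rule avg_eq_avg[of _ rshift lshift uminus, OF b(1) PPo rshift_lshift
          lshift_uminus symmetric])
  have PoP: "avg lshift (avg rshift (op_fun r T)) = op_fun r T" for r
    using avg_commute[of "op_fun r T" rshift lshift, OF b(1) rshift_lshift] PPo by simp
  have avg_T: "avg a (\<lambda>x. (op_fun r T x + op_fun r (P_mu \<mu> T) x) / 2)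
        = (\<lambda>x. (avg a (op_fun r T) x + avg a (op_fun r (P_mu \<mu> T)) x) / 2)"
      "avg a (\<lambda>x. (op_fun r T x - op_fun r (P_mu \<mu> T) x) / 2)
        = (\<lambda>x. (avg a (op_fun r T) x - avg a (op_fun r (P_mu \<mu> T)) x) / 2)" for a r
    using avg_linear[OF lin bounded_plus_comp[OF b], of a r r]
      avg_linear[OF lin bounded_minus_comp[OF b], of a r r]
    by (simp_all add: avg_add[OF b] avg_diff[OF b])
  have "bounded_op T0" "bounded_op T1"
    unfolding T0_def T1_def by (intro bounded_op_combination T bounded_op_P_mu)+
  moreover have "op_eq T (op_add T0 T1)"
    by (simp add: op_eq_iff_op_fun op_fun_add T0_fun T1_fun fun_eq_iff field_simps)
  \<comment> \<open>By \<open>PP\<close>, \<open>Po\<close> and \<open>PoP\<close>, each of the two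
    averages exchanges \<open>T\<close> and \<open>P T\<close>, hence fixes their half-sum and
    negates their half-difference.\<close>
  moreover have "op_eq (P_mu \<mu> T0) T0" "op_eq (Po_mu \<mu> T0) T0"
    "op_eq (P_mu \<mu> T1) (op_neg T1)" "op_eq (Po_mu \<mu> T1) (op_neg T1)"
    unfolding op_eq_iff_op_fun op_fun_neg op_fun_P_mu[of _ T0] op_fun_Po_mu[of _ T0]
      op_fun_P_mu[of _ T1] op_fun_Po_mu[of _ T1] T0_fun T1_fun avg_T
    by (simp_all add: op_fun_P_mu PP Po PoP fun_eq_iff field_simps)
  ultimately show ?thesis by (auto simp: is_splitting_def)
qed

end

theorem theorem3p3:
  fixes \<mu> :: "'g::{group_add, countable} \<Rightarrow> real" and T :: "'g op"
  assumes "symmetric_prob \<mu>"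
    and "bounded_op T"
    and "op_eq (P_mu \<mu> (Po_mu \<mu> T)) T"
  shows "(\<exists>T0 T1. bounded_op T0 \<and> bounded_op T1 \<and> op_eq T (op_add T0 T1)
            \<and> op_eq (P_mu \<mu> T0) T0 \<and> op_eq (Po_mu \<mu> T0) T0
            \<and> op_eq (P_mu \<mu> T1) (op_neg T1) \<and> op_eq (Po_mu \<mu> T1) (op_neg T1))
       \<and> (\<forall>T0 T1 S0 S1.
            bounded_op T0 \<and> bounded_op T1 \<and> op_eq T (op_add T0 T1)
            \<and> op_eq (P_mu \<mu> T0) T0 \<and> op_eq (Po_mu \<mu> T0) T0
            \<and> op_eq (P_mu \<mu> T1) (op_neg T1) \<and> op_eq (Po_mu \<mu> T1) (op_neg T1)
          \<and> bounded_op S0 \<and> bounded_op S1 \<and> op_eq T (op_add S0 S1)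
            \<and> op_eq (P_mu \<mu> S0) S0 \<and> op_eq (Po_mu \<mu> S0) S0
            \<and> op_eq (P_mu \<mu> S1) (op_neg S1) \<and> op_eq (Po_mu \<mu> S1) (op_neg S1)
          \<longrightarrow> op_eq T0 S0 \<and> op_eq T1 S1)"
proof -
  interpret symmetric_weight \<mu>
    using assms(1) by unfold_locales (auto simp: symmetric_prob_def)
  show ?thesis
    using splitting_exists[OF assms(2,3)] splitting_unique[of T]
    unfolding is_splitting_def by blast
qed

end
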